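(* Let $E$ be a graph and $w\in\mathrm{reg}(E)$ a vertex that does not emit a loop. (1) Let $E_R$ be the reduction of $E$ at $w$. Then the formulas $f(v)=v$ for $v\in E_R^0$, $f(e)=e$ for $e\in E^1\setminus(s_E^{-1}(w)\sqcup t_E^{-1}(w))$, and $f(p)=eg$ (the path of length two in $E$) for an edge $p=eg$ of $E_R$ with $t_E(e)=w=s_E(g)$, define an admissible path homomorphism $f\colon \mathrm{FP}(E_R)\to \mathrm{FP}(E)$. (2) Let $E_{R+}$ be the unital reduction of $E$ at $w$. Then the formulas $f(v)=v$ for $v\in E_{R+}^0$, $f(e)=e$ for $e\in E^1\setminus t_E^{-1}(w)$, and $f(p)=eg$ (the path of length two in $E$) for an edge $p=eg$ of $E_{R+}$ with $t_E(e)=w=s_E(g)$, define an admissible path homomorphism $f\colon \mathrm{FP}(E_{R+})\to \mathrm{FP}(E)$.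
   Context: A graph $E=(E^0,E^1,s_E,t_E)$ consists of arbitrary sets of vertices and edges with source and target maps. A vertex $v$ is regular if $s_E^{-1}(v)$ is finite and nonempty; $\mathrm{reg}(E)$ is the set of regular vertices, and $\mathrm{reg}_0(E)=\{v\in\mathrm{reg}(E)\mid s_E^{-1}(v)=\{e\}\text{ and }t_E(e)=v\}$. $\mathrm{FP}(E)$ is the set of finite paths (vertices, of length $0$, and sequences $e_1\ldots e_n$ of edges with $t_E(e_i)=s_E(e_{i+1})$); source and target extend to paths, vertices act as units for concatenation. Write $\alpha\preceq\beta$ if $\beta=\alpha\gamma$ for some path $\gamma$. Reduction at $w$: $E_R^0=E^0\setminus\{w\}$, $E_R^1=\big(E^1\setminus(s_E^{-1}(w)\sqcup t_E^{-1}(w))\big)\sqcup\{eg\mid t_E(e)=w=s_E(g)\}$, where old edges keep their sources and targets and the edge $eg$ has source $s_E(e)$ and target $t_E(g)$. Unital reduction at $w$: $E_{R+}^0=E^0$, $E_{R+}^1=(E^1\setminus t_E^{-1}(w))\sqcup\{eg\mid t_E(e)=w=s_E(g)\}$, with sources and targets given by the same rule. A path homomorphism from $E$ to $F$ is a map $f\colon \mathrm{FP}(E)\to\mathrm{FP}(F)$ with $f(E^0)\subseteq F^0$, commuting with source and target, and with $f(pq)=f(p)f(q)$ whenever $t_E(p)=s_E(q)$. It is monotonic if for edges $e,e'\in E^1$, $f(e)\preceq f(e')$ implies $e=e'$. For $v\in\mathrm{reg}(E)$ consider the condition $(\ast_v)$: (a) $f$ is injective on $s_E^{-1}(v)$;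 and (b) a path $p$ in $F$ lies in $f(s_E^{-1}(v))$ if and only if (i) $p=e_1\ldots e_n$ with $n\ge1$ and all $e_i\in F^1$, (ii) $pq\in f(s_E^{-1}(v))$ implies $q=t_F(p)$, and (iii) for all $i\in\{1,\ldots,n\}$ and $e\in s_F^{-1}(s_F(e_i))$ there is $r\in\mathrm{FP}(F)$ with $e_1\ldots e_{i-1}er\in f(s_E^{-1}(v))$. The path homomorphism $f$ is regular if $(\ast_v)$ holds for every $v\in\mathrm{reg}(E)\setminus\mathrm{reg}_0(E)$ and, for every $v\in\mathrm{reg}_0(E)$, either $(\ast_v)$ holds or $f(s_E^{-1}(v))=\{f(v)\}$. A path homomorphism is admissible if it is injective on vertices, monotonic and regular. *)

theory Defs
  imports "Graph_Theory.Arc_Walk" "HOL-Library.FuncSet"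
begin

text \<open>
  Graphs are the \<^locale>\<open>wf_digraph\<close> structures: arbitrary (possibly infinite) sets
  of vertices and edges, with loops and parallel edges allowed. The source map is \<^const>\<open>tail\<close> and
  the target map is \<^const>\<open>head\<close>.
\<close>

definition reg :: "('v, 'e) pre_digraph \<Rightarrow> 'v set" where
  "reg E = {v \<in> verts E. finite (out_arcs E v) \<and> out_arcs E v \<noteq> {}}"

definition reg0 :: "('v, 'e) pre_digraph \<Rightarrow> 'v set" where
  "reg0 E = {v \<in> reg E. \<exists>e. out_arcs E v = {e} \<and> head E e = v}"


text \<open>
  A finite path is a pair of its source vertex and its list of edges, so that the paths of length
  \<open>0\<close> are the pairs \<open>(v, [])\<close>. Concatenation \<open>pcat p q\<close> is meaningful only if the
  target of \<open>p\<close> is the source of \<open>q\<close>; all uses below ensure this.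
\<close>

type_synonym ('v, 'e) path = "'v \<times> 'e list"

definition FP :: "('v, 'e) pre_digraph \<Rightarrow> ('v, 'e) path set" where
  "FP E = {(u, es). \<exists>v. pre_digraph.awalk E u es v}"

definition psrc :: "('v, 'e) path \<Rightarrow> 'v" where
  "psrc p = fst p"

definition ptgt :: "('v, 'e) pre_digraph \<Rightarrow> ('v, 'e) path \<Rightarrow> 'v" where
  "ptgt E p = pre_digraph.awlast E (fst p) (snd p)"

definition vpath :: "'v \<Rightarrow> ('v, 'e) path" where
  "vpath v = (v, [])"

definition epath :: "('v, 'e) pre_digraph \<Rightarrow> 'e \<Rightarrow> ('v, 'e) path" where
  "epath E e = (tail E e, [e])"

definition pcat :: "('v, 'e) path \<Rightarrow> ('v, 'e) path \<Rightarrow> ('v, 'e) path" where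
  "pcat p q = (fst p, snd p @ snd q)"

definition path_prefix :: "('v, 'e) pre_digraph \<Rightarrow> ('v, 'e) path \<Rightarrow> ('v, 'e) path \<Rightarrow> bool" where
  "path_prefix E p q \<longleftrightarrow> (\<exists>r\<in>FP E. ptgt E p = psrc r \<and> q = pcat p r)"


text \<open>
  The edge \<open>eg\<close> of a reduction is \<open>Inr (e, g)\<close>; an old edge \<open>e\<close> is \<open>Inl e\<close>.
\<close>

definition reduction :: "('v, 'e) pre_digraph \<Rightarrow> 'v \<Rightarrow> ('v, 'e + 'e \<times> 'e) pre_digraph" where
  "reduction E w =
    \<lparr> verts = verts E - {w},
      arcs = (arcs E - (out_arcs E w \<union> in_arcs E w)) <+> (in_arcs E w \<times> out_arcs E w),
      tail = case_sum (tail E) (\<lambda>(e, g). tail E e),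
      head = case_sum (head E) (\<lambda>(e, g). head E g) \<rparr>"

definition unital_reduction ::
    "('v, 'e) pre_digraph \<Rightarrow> 'v \<Rightarrow> ('v, 'e + 'e \<times> 'e) pre_digraph" where
  "unital_reduction E w =
    \<lparr> verts = verts E,
      arcs = (arcs E - in_arcs E w) <+> (in_arcs E w \<times> out_arcs E w),
      tail = case_sum (tail E) (\<lambda>(e, g). tail E e),
      head = case_sum (head E) (\<lambda>(e, g). head E g) \<rparr>"

lemma wf_digraph_reduction:
  assumes "wf_digraph E" "\<not> (\<exists>e\<in>out_arcs E w. head E e = w)"
  shows "wf_digraph (reduction E w)"
  using assms
  by (auto simp: wf_digraph_def reduction_def in_arcs_def out_arcs_def)

lemma wf_digraph_unital_reduction:
  assumes "wf_digraph E"
  shows "wf_digraph (unital_reduction E w)"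
  using assms
  by (auto simp: wf_digraph_def unital_reduction_def in_arcs_def out_arcs_def)


text \<open>
  The extensional function space makes a path homomorphism a genuine map from \<open>FP E\<close> to
  \<open>FP F\<close>, so that uniqueness statements are meaningful.
\<close>

definition path_hom ::
    "('v, 'e) pre_digraph \<Rightarrow> ('u, 'd) pre_digraph \<Rightarrow> (('v, 'e) path \<Rightarrow> ('u, 'd) path) \<Rightarrow> bool" where
  "path_hom E F f \<longleftrightarrow>
    f \<in> FP E \<rightarrow>\<^sub>E FP F \<and>
    f ` vpath ` verts E \<subseteq> vpath ` verts F \<and>
    (\<forall>p\<in>FP E. vpath (psrc (f p)) = f (vpath (psrc p))) \<and>
    (\<forall>p\<in>FP E. vpath (ptgt F (f p)) = f (vpath (ptgt E p))) \<and>
    (\<forall>p\<in>FP E. \<forall>q\<in>FP E. ptgt E p = psrc q \<longrightarrow> f (pcat p q) = pcat (f p) (f q))"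

definition monotonic ::
    "('v, 'e) pre_digraph \<Rightarrow> ('u, 'd) pre_digraph \<Rightarrow> (('v, 'e) path \<Rightarrow> ('u, 'd) path) \<Rightarrow> bool" where
  "monotonic E F f \<longleftrightarrow>
    (\<forall>e\<in>arcs E. \<forall>e'\<in>arcs E. path_prefix F (f (epath E e)) (f (epath E e')) \<longrightarrow> e = e')"

text \<open>
  In the last clause below the list index \<open>i\<close> starts at \<open>0\<close>, so that \<open>take i\<close>
  yields the part of the path strictly before the edge at position \<open>i\<close>.
\<close>

definition star_cond ::
    "('v, 'e) pre_digraph \<Rightarrow> ('u, 'd) pre_digraph \<Rightarrow> (('v, 'e) path \<Rightarrow> ('u, 'd) path) \<Rightarrow> 'v \<Rightarrow> bool" where
  "star_cond E F f v \<longleftrightarrow>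
    (let S = epath E ` out_arcs E v in
      inj_on f S \<and>
      (\<forall>p\<in>FP F. p \<in> f ` S \<longleftrightarrow>
        length (snd p) \<ge> 1 \<and>
        (\<forall>q\<in>FP F. ptgt F p = psrc q \<and> pcat p q \<in> f ` S \<longrightarrow> q = vpath (ptgt F p)) \<and>
        (\<forall>i<length (snd p). \<forall>e\<in>out_arcs F (tail F (snd p ! i)).
          \<exists>r\<in>FP F. head F e = psrc r \<and>
            pcat (pcat (fst p, take i (snd p)) (epath F e)) r \<in> f ` S)))"

definition regular ::
    "('v, 'e) pre_digraph \<Rightarrow> ('u, 'd) pre_digraph \<Rightarrow> (('v, 'e) path \<Rightarrow> ('u, 'd) path) \<Rightarrow> bool" where
  "regular E F f \<longleftrightarrow>
    (\<forall>v\<in>reg E - reg0 E. star_cond E F f v) \<and>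
    (\<forall>v\<in>reg0 E. star_cond E F f v \<or> f ` epath E ` out_arcs E v = {f (vpath v)})"

definition admissible ::
    "('v, 'e) pre_digraph \<Rightarrow> ('u, 'd) pre_digraph \<Rightarrow> (('v, 'e) path \<Rightarrow> ('u, 'd) path) \<Rightarrow> bool" where
  "admissible E F f \<longleftrightarrow>
    path_hom E F f \<and> inj_on f (vpath ` verts E) \<and> monotonic E F f \<and> regular E F f"


definition reduction_formulas ::
    "('v, 'e) pre_digraph \<Rightarrow> 'v \<Rightarrow> (('v, 'e + 'e \<times> 'e) path \<Rightarrow> ('v, 'e) path) \<Rightarrow> bool" where
  "reduction_formulas E w f \<longleftrightarrow>
    (\<forall>v\<in>verts (reduction E w). f (vpath v) = vpath v) \<and>
    (\<forall>e\<in>arcs E - (out_arcs E w \<union> in_arcs E w).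
      f (epath (reduction E w) (Inl e)) = epath E e) \<and>
    (\<forall>e\<in>in_arcs E w. \<forall>g\<in>out_arcs E w.
      f (epath (reduction E w) (Inr (e, g))) = pcat (epath E e) (epath E g))"

definition unital_reduction_formulas ::
    "('v, 'e) pre_digraph \<Rightarrow> 'v \<Rightarrow> (('v, 'e + 'e \<times> 'e) path \<Rightarrow> ('v, 'e) path) \<Rightarrow> bool" where
  "unital_reduction_formulas E w f \<longleftrightarrow>
    (\<forall>v\<in>verts (unital_reduction E w). f (vpath v) = vpath v) \<and>
    (\<forall>e\<in>arcs E - in_arcs E w.
      f (epath (unital_reduction E w) (Inl e)) = epath E e) \<and>
    (\<forall>e\<in>in_arcs E w. \<forall>g\<in>out_arcs E w.
      f (epath (unital_reduction E w) (Inr (e, g))) = pcat (epath E e) (epath E g))"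

end

theory Submission
  imports Defs
begin

text \<open>
  On paths the homomorphism replaces every edge \<open>eg\<close> by the two edges \<open>e\<close>, \<open>g\<close>, and
  this is forced by its values on edges. For a vertex \<open>v\<close> of either reduction, the images of the
  edges emitted by \<open>v\<close> are the edges \<open>e\<close> from \<open>v\<close> with target other than \<open>w\<close> together
  with all paths \<open>eg\<close> from \<open>v\<close> whose midpoint is \<open>w\<close>. No such path is a proper prefix of
  another, and since \<open>w\<close> emits an edge, each edge from \<open>v\<close> begins one of them. In the
  converse direction of \<open>(*\<^sub>v)\<close>, clause (iii) at the last edge of \<open>p\<close> shows that some
  extension of \<open>p\<close> lies in the image, and by clause (ii) this extension is \<open>p\<close> itself.
\<close>

section \<open>Elementary facts on finite paths\<close>

lemma FP_arcs: "(u, es) \<in> FP G \<Longrightarrow> set es \<subseteq> arcs G"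
  by (auto simp: FP_def pre_digraph.awalk_def)

lemma ptgt_snoc: "ptgt G (u, es @ [a]) = head G a"
  by (simp add: ptgt_def pre_digraph.awalk_verts_conv)

context wf_digraph
begin

lemma FP_Nil_iff: "(u, []) \<in> FP G \<longleftrightarrow> u \<in> verts G"
  by (auto simp: FP_def awalk_def)

lemma FP_Cons_iff:
  "(u, a # es) \<in> FP G \<longleftrightarrow> a \<in> arcs G \<and> tail G a = u \<and> (head G a, es) \<in> FP G"
  by (auto simp: FP_def awalk_Cons_iff)

lemma ptgt_Nil: "ptgt G (u, []) = u"
  by (simp add: ptgt_def)

lemma ptgt_Cons: "ptgt G (u, a # es) = ptgt G (head G a, es)"
  by (simp add: ptgt_def)

lemma ptgt_in_verts: "(u, es) \<in> FP G \<Longrightarrow> ptgt G (u, es) \<in> verts G"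
  by (induction es arbitrary: u) (auto simp: FP_Nil_iff FP_Cons_iff ptgt_Nil ptgt_Cons)

lemmas FP_simps = FP_Nil_iff FP_Cons_iff ptgt_Nil ptgt_Cons

end

text \<open>This settles the converse half of \<open>star_cond\<close> for arbitrary graphs, so that
  only properties of paths already in the image remain to be checked.\<close>

lemma star_condI:
  assumes inj: "inj_on f (epath E ` out_arcs E v)"
    and nonempty: "\<And>p. p \<in> f ` epath E ` out_arcs E v \<Longrightarrow> snd p \<noteq> []"
    and prefix_free: "\<And>p q. p \<in> f ` epath E ` out_arcs E v \<Longrightarrow> q \<in> FP F \<Longrightarrow>
      ptgt F p = psrc q \<Longrightarrow> pcat p q \<in> f ` epath E ` out_arcs E v \<Longrightarrow> q = vpath (ptgt F p)"
    and exits: "\<And>p i e. p \<in> f ` epath E ` out_arcs E v \<Longrightarrow> i < length (snd p) \<Longrightarrow>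
      e \<in> out_arcs F (tail F (snd p ! i)) \<Longrightarrow>
      \<exists>r\<in>FP F. head F e = psrc r \<and>
        pcat (pcat (fst p, take i (snd p)) (epath F e)) r \<in> f ` epath E ` out_arcs E v"
  shows "star_cond E F f v"
proof -
  let ?I = "f ` epath E ` out_arcs E v"
  have converse: "p \<in> ?I" if p: "p \<in> FP F" and len: "length (snd p) \<ge> 1"
    and ii: "\<forall>q\<in>FP F. ptgt F p = psrc q \<and> pcat p q \<in> ?I \<longrightarrow> q = vpath (ptgt F p)"
    and iii: "\<forall>i<length (snd p). \<forall>e\<in>out_arcs F (tail F (snd p ! i)).
      \<exists>r\<in>FP F. head F e = psrc r \<and> pcat (pcat (fst p, take i (snd p)) (epath F e)) r \<in> ?I"
    for p
  proof -
    obtain u es a where p_eq: "p = (u, es @ [a])"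
      using len by (cases p; cases "snd p" rule: rev_cases) auto
    have "a \<in> arcs F" and tgt: "ptgt F p = head F a"
      using p FP_arcs[of u "es @ [a]" F] by (simp_all add: p_eq ptgt_snoc)
    then have "a \<in> out_arcs F (tail F a)"
      by simp
    \<comment> \<open>Positions count from 0, so \<open>length es\<close> is that of the last edge
      \<open>a\<close>. Choosing \<open>a\<close> itself as the exit reproduces all of
      \<open>p\<close> before \<open>r\<close>.\<close>
    with iii[rule_format, of "length es" a] obtain r where r: "r \<in> FP F" "head F a = psrc r"
      and "pcat (pcat (u, es) (epath F a)) r \<in> ?I"
      by (auto simp: p_eq)
    then have cat: "pcat p r \<in> ?I"
      by (simp add: p_eq pcat_def epath_def)
    with ii r tgt have "r = vpath (ptgt F p)"
      by simp
    with cat show ?thesis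
      by (simp add: p_eq pcat_def vpath_def)
  qed
  have "p \<in> ?I \<longleftrightarrow> length (snd p) \<ge> 1 \<and>
      (\<forall>q\<in>FP F. ptgt F p = psrc q \<and> pcat p q \<in> ?I \<longrightarrow> q = vpath (ptgt F p)) \<and>
      (\<forall>i<length (snd p). \<forall>e\<in>out_arcs F (tail F (snd p ! i)).
        \<exists>r\<in>FP F. head F e = psrc r \<and> pcat (pcat (fst p, take i (snd p)) (epath F e)) r \<in> ?I)"
    (is "_ \<longleftrightarrow> ?C p") if "p \<in> FP F" for p
  proof
    assume "p \<in> ?I"
    then show "?C p"
      using nonempty prefix_free exits by (simp add: Suc_le_eq)
  next
    assume "?C p"
    then show "p \<in> ?I"
      by (elim conjE) (rule converse[OF that])
  qed
  with inj show ?thesis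
    by (simp add: star_cond_def Let_def)
qed

text \<open>
  The common features of both reductions; they differ only in the vertices and in the set \<open>A\<close>
  of old edges that are kept.
\<close>

locale edge_contraction =
  E: wf_digraph E + R: wf_digraph R
  for E :: "('v, 'e) pre_digraph" and R :: "('v, 'e + 'e \<times> 'e) pre_digraph" +
  fixes w :: 'v and A :: "'e set"
  assumes verts_R: "verts R \<subseteq> verts E"
    and arcs_R: "arcs R = A <+> (in_arcs E w \<times> out_arcs E w)"
    and tail_R: "tail R = case_sum (tail E) (\<lambda>(e, g). tail E e)"
    and head_R: "head R = case_sum (head E) (\<lambda>(e, g). head E g)"
    and A_subset: "A \<subseteq> arcs E - in_arcs E w"
    and out_arcs_subset: "\<And>v. v \<in> verts R \<Longrightarrow> out_arcs E v - in_arcs E w \<subseteq> A"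
    and out_arcs_w: "out_arcs E w \<noteq> {}"
begin

section \<open>Expansion of edges and paths\<close>

definition expand :: "'e + 'e \<times> 'e \<Rightarrow> 'e list" where
  "expand = case_sum (\<lambda>e. [e]) (\<lambda>(e, g). [e, g])"

definition expand_path :: "('v, 'e + 'e \<times> 'e) path \<Rightarrow> ('v, 'e) path" where
  "expand_path = restrict (\<lambda>(u, es). (u, concat (map expand es))) (FP R)"

text \<open>The common form of \<open>reduction_formulas\<close> and
  \<open>unital_reduction_formulas\<close>, which arise from the two choices of
  \<open>A\<close>.\<close>

definition formulas :: "(('v, 'e + 'e \<times> 'e) path \<Rightarrow> ('v, 'e) path) \<Rightarrow> bool" where
  "formulas f \<longleftrightarrow>
    (\<forall>v\<in>verts R. f (vpath v) = vpath v) \<and>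
    (\<forall>e\<in>A. f (epath R (Inl e)) = epath E e) \<and>
    (\<forall>e\<in>in_arcs E w. \<forall>g\<in>out_arcs E w.
      f (epath R (Inr (e, g))) = pcat (epath E e) (epath E g))"

lemma expand_simps [simp]:
  "expand (Inl e) = [e]" "expand (Inr (e, g)) = [e, g]"
  by (simp_all add: expand_def)

lemma arcs_R_simps:
  "Inl e \<in> arcs R \<longleftrightarrow> e \<in> A"
  "Inr (e, g) \<in> arcs R \<longleftrightarrow> e \<in> in_arcs E w \<and> g \<in> out_arcs E w"
  by (auto simp: arcs_R)

lemma arcs_R_cases:
  assumes "a \<in> arcs R"
  obtains (old) e where "a = Inl e" "e \<in> A" "e \<in> arcs E" "head E e \<noteq> w"
      "tail R a = tail E e" "head R a = head E e"
    | (new) e g where "a = Inr (e, g)" "e \<in> arcs E" "head E e = w" "g \<in> arcs E" "tail E g = w"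
      "tail R a = tail E e" "head R a = head E g"
  using assms A_subset by (cases a) (auto simp: arcs_R_simps tail_R head_R)

text \<open>The edges \<open>e\<close> and \<open>g\<close> of a new edge meet in \<open>w\<close>,
  and the pair has the same outer endpoints as the new edge, so consecutive expansions still fit
  together.\<close>

lemma expand_walk:
  assumes "(u, es) \<in> FP R"
  shows "(u, concat (map expand es)) \<in> FP E \<and> ptgt E (u, concat (map expand es)) = ptgt R (u, es)"
  using assms
proof (induction es arbitrary: u)
  case Nil
  then show ?case
    using verts_R by (auto simp: E.FP_simps R.FP_simps)
next
  case (Cons a es)
  then have a: "a \<in> arcs R" "tail R a = u" and es: "(head R a, es) \<in> FP R"
    by (auto simp: R.FP_simps)
  from a(1) show ?case
    by (cases rule: arcs_R_cases) (use a Cons.IH[OF es] in \<open>auto simp: E.FP_simps R.FP_simps\<close>)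
qed

lemma expand_path_eq:
  "(u, es) \<in> FP R \<Longrightarrow> expand_path (u, es) = (u, concat (map expand es))"
  by (simp add: expand_path_def)

lemma epath_in_FP: "a \<in> arcs R \<Longrightarrow> epath R a \<in> FP R"
  by (simp add: epath_def R.FP_simps)

lemma expand_path_epath:
  "a \<in> arcs R \<Longrightarrow> expand_path (epath R a) = (tail R a, expand a)"
  using epath_in_FP[of a] by (simp add: epath_def expand_path_eq)

text \<open>Since \<open>expand_path\<close> is restricted to \<open>FP R\<close>, it can be
  unfolded at a concatenation only after this membership is known.\<close>

lemma pcat_in_FP:
  assumes "(u, es) \<in> FP R" "(u', es') \<in> FP R" "ptgt R (u, es) = u'"
  shows "(u, es @ es') \<in> FP R"
  using assms by (induction es arbitrary: u) (auto simp: R.FP_simps)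

section \<open>Existence and uniqueness of the path homomorphism\<close>

lemma path_hom_expand_path: "path_hom R E expand_path"
  unfolding path_hom_def
proof (intro conjI ballI impI)
  show "expand_path \<in> FP R \<rightarrow>\<^sub>E FP E"
    using expand_walk by (auto simp: expand_path_def)
  show "expand_path ` vpath ` verts R \<subseteq> vpath ` verts E"
    using verts_R by (auto simp: vpath_def expand_path_eq R.FP_simps)
next
  fix p assume "p \<in> FP R"
  then obtain u es where p: "p = (u, es)" "(u, es) \<in> FP R"
    by (cases p) auto
  then have "u \<in> verts R"
    by (auto simp: FP_def R.awalk_def)
  with p show "vpath (psrc (expand_path p)) = expand_path (vpath (psrc p))"
    by (simp add: vpath_def psrc_def expand_path_eq R.FP_simps)
  show "vpath (ptgt E (expand_path p)) = expand_path (vpath (ptgt R p))"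
    using p R.ptgt_in_verts[OF p(2)] expand_walk[OF p(2)]
    by (simp add: vpath_def expand_path_eq R.FP_simps)
  fix q assume "q \<in> FP R" "ptgt R p = psrc q"
  with p show "expand_path (pcat p q) = pcat (expand_path p) (expand_path q)"
    by (cases q) (auto simp: pcat_def psrc_def expand_path_eq pcat_in_FP)
qed

lemma formulas_expand_path: "formulas expand_path"
  unfolding formulas_def
  by (simp add: expand_path_epath arcs_R_simps tail_R epath_def[of E] pcat_def vpath_def
      expand_path_eq R.FP_simps)

lemma formulas_epath:
  assumes "formulas f" "a \<in> arcs R"
  shows "f (epath R a) = (tail R a, expand a)"
  using assms by (auto simp: formulas_def arcs_R tail_R epath_def[of E] pcat_def)

lemma path_hom_unique:
  assumes hom: "path_hom R E f" and f: "formulas f"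
  shows "f = expand_path"
proof -
  have "f (u, es) = (u, concat (map expand es))" if "(u, es) \<in> FP R" for u es
    using that
  proof (induction es arbitrary: u)
    case Nil
    with f show ?case
      by (simp add: formulas_def vpath_def R.FP_simps)
  next
    case (Cons a es)
    then have a: "a \<in> arcs R" "tail R a = u" and es: "(head R a, es) \<in> FP R"
      by (auto simp: R.FP_simps)
    have "ptgt R (epath R a) = psrc (head R a, es)"
      by (simp add: epath_def psrc_def R.FP_simps)
    with hom a(1) es have
      "f (pcat (epath R a) (head R a, es)) = pcat (f (epath R a)) (f (head R a, es))"
      using epath_in_FP unfolding path_hom_def by blast
    with formulas_epath[OF f a(1)] Cons.IH[OF es] a(2) show ?case
      by (simp add: pcat_def epath_def)
  qed
  \<comment> \<open>Outside \<open>FP R\<close> both maps are \<open>undefined\<close>, so agreement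
    on paths gives equality of functions.\<close>
  moreover have "f \<in> extensional (FP R)"
    using hom by (auto simp: path_hom_def PiE_def)
  ultimately show ?thesis
    by (intro extensionalityI[of f "FP R"]) (auto simp: expand_path_def)
qed

section \<open>Prefix-freeness and admissibility\<close>

lemma expand_prefix_free:
  assumes "a \<in> arcs R" "b \<in> arcs R" "expand b = expand a @ es"
  shows "a = b \<and> es = []"
  \<comment> \<open>The critical case is \<open>[e]\<close> against \<open>[e, g]\<close>: an old
    edge does not end in \<open>w\<close>, whereas the first half of a new edge does.\<close>
  using assms by (elim arcs_R_cases) auto

lemma star_cond_expand_path:
  assumes v: "v \<in> verts R"
  shows "star_cond R E expand_path v"
proof (rule star_condI)
  let ?I = "expand_path ` epath R ` out_arcs R v"
  have I_eq: "?I = (\<lambda>a. (v, expand a)) ` out_arcs R v"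
    unfolding image_image by (rule image_cong) (auto simp: expand_path_epath)
  show "inj_on expand_path (epath R ` out_arcs R v)"
  proof (intro inj_onI, elim imageE, simp only:)
    fix a b
    assume "a \<in> out_arcs R v" "b \<in> out_arcs R v"
      and "expand_path (epath R a) = expand_path (epath R b)"
    \<comment> \<open>Equal images are prefixes of each other with empty remainder.\<close>
    then show "epath R a = epath R b"
      using expand_prefix_free[of b a "[]"] by (simp add: expand_path_epath)
  qed
  show "snd p \<noteq> []" if "p \<in> ?I" for p
    using that by (auto simp: I_eq expand_def split: sum.splits)
  show "q = vpath (ptgt E p)"
    if "p \<in> ?I" "q \<in> FP E" "ptgt E p = psrc q" "pcat p q \<in> ?I" for p q
  proof -
    obtain a where a: "a \<in> arcs R" "p = (v, expand a)"
      using \<open>p \<in> ?I\<close> by (auto simp: I_eq)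
    moreover obtain b where "b \<in> arcs R" "pcat p q = (v, expand b)"
      using \<open>pcat p q \<in> ?I\<close> by (auto simp: I_eq)
    moreover from this a have "expand b = expand a @ snd q"
      by (simp add: pcat_def)
    ultimately show ?thesis
      using expand_prefix_free that(3)
      by (cases q) (auto simp: psrc_def vpath_def)
  qed

  \<comment> \<open>An edge into \<open>w\<close> is not an image by itself;
    \<open>g\<^sub>0\<close> completes it to one.\<close>
  obtain g\<^sub>0 where "g\<^sub>0 \<in> out_arcs E w"
    using out_arcs_w by blast
  then have g\<^sub>0: "g\<^sub>0 \<in> arcs E" "tail E g\<^sub>0 = w"
    by simp_all
  \<comment> \<open>This is clause (iii) at position 0, shared by old and new edges.\<close>
  have first: "\<exists>r\<in>FP E. head E e = psrc r \<and> (v, e # snd r) \<in> ?I"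
    if "e \<in> arcs E" "tail E e = v" for e
  proof (cases "head E e = w")
    case True
    with that g\<^sub>0 have "Inr (e, g\<^sub>0) \<in> out_arcs R v"
      by (auto simp: arcs_R_simps tail_R)
    then have "(v, [e, g\<^sub>0]) \<in> ?I"
      by (force simp: I_eq)
    with True g\<^sub>0 show ?thesis
      by (intro bexI[of _ "(w, [g\<^sub>0])"]) (auto simp: psrc_def E.FP_simps)
  next
    case False
    with that out_arcs_subset[OF v] have "e \<in> A"
      by auto
    with that have "Inl e \<in> out_arcs R v"
      by (auto simp: arcs_R_simps tail_R)
    then have "(v, [e]) \<in> ?I"
      by (force simp: I_eq)
    with that show ?thesis
      by (intro bexI[of _ "(head E e, [])"]) (auto simp: psrc_def E.FP_simps)
  qed
  show "\<exists>r\<in>FP E. head E e = psrc r \<and>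
      pcat (pcat (fst p, take i (snd p)) (epath E e)) r \<in> ?I"
    if p: "p \<in> ?I" and i: "i < length (snd p)" and e: "e \<in> out_arcs E (tail E (snd p ! i))"
    for p i e
  proof -
    from p obtain a where a: "a \<in> arcs R" "tail R a = v" and p_eq: "p = (v, expand a)"
      by (auto simp: I_eq)
    from a(1) show ?thesis
    proof (cases rule: arcs_R_cases)
      case (old e')
      with first[of e] i e a p_eq show ?thesis
        by (simp add: pcat_def epath_def)
    next
      case (new e' g)
      consider "i = 0" | "i = 1"
        using i new p_eq by fastforce
      then show ?thesis
      proof cases
        case 1
        with first[of e] new e a p_eq show ?thesis
          by (simp add: pcat_def epath_def)
      next
        case 2
        \<comment> \<open>At position 1 the path stands at \<open>w\<close>. Replacing
          \<open>g\<close> by any other exit \<open>e\<close> gives the new edge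
          \<open>(e', e)\<close>, so the trivial path at \<open>head E e\<close> serves as
          \<open>r\<close>.\<close>
        with new e p_eq have e': "e \<in> arcs E" "tail E e = w"
          by auto
        with new a have "Inr (e', e) \<in> out_arcs R v"
          by (auto simp: arcs_R_simps tail_R)
        then have "(v, [e', e]) \<in> ?I"
          by (force simp: I_eq)
        with 2 new e' p_eq show ?thesis
          by (intro bexI[of _ "(head E e, [])"])
            (auto simp: pcat_def epath_def psrc_def E.FP_simps)
      qed
    qed
  qed
qed

lemma admissible_expand_path: "admissible R E expand_path"
  unfolding admissible_def
proof (intro conjI path_hom_expand_path)
  show "inj_on expand_path (vpath ` verts R)"
    by (auto intro!: inj_onI simp: vpath_def expand_path_eq R.FP_simps)
  show "monotonic R E expand_path"
    unfolding monotonic_def path_prefix_def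
    by (auto simp: expand_path_epath pcat_def dest: expand_prefix_free)
  show "regular R E expand_path"
    \<comment> \<open>\<open>star_cond\<close> holds at every vertex of \<open>R\<close>, which
      covers \<open>reg0 R\<close> and its complement in \<open>reg R\<close> together.\<close>
    unfolding regular_def using star_cond_expand_path by (auto simp: reg_def reg0_def)
qed

theorem ex1_admissible:
  "(\<exists>!f. path_hom R E f \<and> formulas f) \<and>
   (\<forall>f. path_hom R E f \<and> formulas f \<longrightarrow> admissible R E f)"
  using path_hom_expand_path formulas_expand_path path_hom_unique admissible_expand_path by blast

end

theorem proposition5p21:
  fixes E :: "('v, 'e) pre_digraph" and w :: 'v
  assumes "wf_digraph E"
    and "w \<in> reg E"
    and "\<not> (\<exists>e\<in>out_arcs E w. head E e = w)"
  shows "((\<exists>!f. path_hom (reduction E w) E f \<and> reduction_formulas E w f) \<and>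
          (\<forall>f. path_hom (reduction E w) E f \<and> reduction_formulas E w f
             \<longrightarrow> admissible (reduction E w) E f)) \<and>
         ((\<exists>!f. path_hom (unital_reduction E w) E f \<and> unital_reduction_formulas E w f) \<and>
          (\<forall>f. path_hom (unital_reduction E w) E f \<and> unital_reduction_formulas E w f
             \<longrightarrow> admissible (unital_reduction E w) E f))"
proof -
  have out: "out_arcs E w \<noteq> {}"
    using assms(2) by (simp add: reg_def)
  \<comment> \<open>As \<open>w\<close> emits no loop, new edges neither start nor end in the
    removed vertex. A remaining vertex differs from \<open>w\<close>, so its edges not ending in
    \<open>w\<close> are all kept.\<close>
  interpret R: edge_contraction E "reduction E w" w "arcs E - (out_arcs E w \<union> in_arcs E w)"
    by (intro edge_contraction.intro edge_contraction_axioms.intro wf_digraph_reduction assms out)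
      (auto simp: reduction_def)
  \<comment> \<open>Here \<open>w\<close> stays a vertex, and its outgoing edges not ending in
    \<open>w\<close> stay in \<open>A\<close>.\<close>
  interpret U: edge_contraction E "unital_reduction E w" w "arcs E - in_arcs E w"
    by (intro edge_contraction.intro edge_contraction_axioms.intro wf_digraph_unital_reduction
        assms out) (auto simp: unital_reduction_def)
  have "R.formulas = reduction_formulas E w" "U.formulas = unital_reduction_formulas E w"
    by (simp_all add: fun_eq_iff R.formulas_def U.formulas_def reduction_formulas_def
        unital_reduction_formulas_def)
  with R.ex1_admissible U.ex1_admissible show ?thesis
    by simp
qed

end
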